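(* Let $\{\eta^i_q\in V_{\mathbb{H}}^R \mid i=1,2,\dots,n,\ q\in\mathbb{H}\}$ be a rank $n$ continuous frame in $V_{\mathbb{H}}^R$ with bounds $m(A)$ and $M(A)$, and let $\{\overline{\eta}^i_q\in V_{\mathbb{H}}^R \mid i=1,2,\dots,n,\ q\in\mathbb{H}\}$ be the dual frame of $\{\eta^i_q \mid i=1,2,\dots,n,\ q\in\mathbb{H}\}$ with bounds $C,D$. Suppose that $\{\Psi^i_q \mid i=1,2,\dots,n,\ q\in\mathbb{H}\}$ is a family in $V_{\mathbb{H}}^R$. Let $K$ be the closed right span over $\mathbb{H}$ of $\{\Psi^i_q \mid i=1,\dots,n,\ q\in\mathbb{H}\}$ and $L$ the closed right span over $\mathbb{H}$ of $\{\eta^i_q \mid i=1,\dots,n,\ q\in\mathbb{H}\}$. Assume that $\delta(K,L)<1$. If $\{\Psi^i_q\}$ satisfies the following conditions: (1) $\lambda:=\sum_{i=1}^{n}\int_{\mathbb{H}}\|\eta^i_q-\Psi^i_q\|^{2}\,d\mu(q)<\infty$; (2) $\gamma:=\sum_{i=1}^{n}\int_{\mathbb{H}}\|\eta^i_q-\Psi^i_q\|\,\|\overline{\eta}^i_q\|\,d\mu(q)<1$, then $\{\Psi^i_q \mid i=1,2,\dots,n,\ q\in\mathbb{H}\}$ is a rank $n$ continuous frame with bounds $\frac{(1-\gamma)^{2}}{D}$ and $M(A)\left(1+\sqrt{\frac{\lambda}{M(A)}}\right)^{2}\frac{1}{(1-\delta(K,L))^{2}}$. Moreover, the restriction of the orthogonal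 projection $P_L$ (onto $L$) to $K$ is an isomorphism from $K$ onto $L$.
   Context: $\mathbb{H}$ denotes the quaternions, equipped with a fixed measure $\mu$; $n\ge 1$ is an integer. $V_{\mathbb{H}}^R$ is a separable right quaternionic Hilbert space, whose inner product $\langle\cdot|\cdot\rangle$ is $\mathbb{H}$-valued with $\overline{\langle\phi|\psi\rangle}=\langle\psi|\phi\rangle$, $\langle\phi|\psi p\rangle=\langle\phi|\psi\rangle p$, $\langle\phi p|\psi\rangle=\overline{p}\langle\phi|\psi\rangle$. Operators are right linear, and $|\eta\rangle\langle\zeta|$ denotes the operator $\phi\mapsto\eta\langle\zeta|\phi\rangle$. Rank $n$ continuous frame with bounds $C,D>0$: a family $\{\xi^i_q\in V_{\mathbb{H}}^R \mid i=1,\dots,n,\ q\in\mathbb{H}\}$ with $C\|\phi\|^2\le\sum_{i=1}^n\int_{\mathbb{H}}|\langle\xi^i_q|\phi\rangle|^2\,d\mu(q)\le D\|\phi\|^2$ for all $\phi\in V_{\mathbb{H}}^R$. Frame operator of $\{\eta^i_q\}$: $A=\sum_{i=1}^n\int_{\mathbb{H}}|\eta^i_q\rangle\langle\eta^i_q|\,d\mu(q)$, a positive bounded operator with bounded inverse; the bounds of $\{\eta^i_q\}$ are $m(A)=\inf_{\|\phi\|=1}\langle\phi|A\phi\rangle$ and $M(A)=\sup_{\|\phi\|=1}\langle\phi|A\phi\rangle$. Dual frame of $\{\eta^i_q\}$: the rank $n$ continuous frame $\{\overline{\eta}^i_q\}$ with $\overline{\eta}^i_q=A^{-1}\eta^i_q$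 (the bar is only notation); $C,D$ denote its lower and upper frame bounds. Gap: for subspaces $K,L$ of $V_{\mathbb{H}}^R$ with $K\ne\{0\}$, $\delta(K,L):=\sup_{\phi\in K,\|\phi\|=1}\inf_{\psi\in L}\|\phi-\psi\|$; and $\delta(K,L)=0$ if $K=\{0\}$. *)

theory Defs
  imports "HOL-Analysis.Analysis"
begin

section \<open>Quaternions\<close>

datatype quat = Quat (qRe: real) (qI: real) (qJ: real) (qK: real)

lemma quat_eq_iff: "x = y \<longleftrightarrow> qRe x = qRe y \<and> qI x = qI y \<and> qJ x = qJ y \<and> qK x = qK y"
  by (cases x; cases y) simp

instantiation quat :: ring_1
begin

definition "0 = Quat 0 0 0 0"
definition "1 = Quat 1 0 0 0"
definition "x + y = Quat (qRe x + qRe y) (qI x + qI y) (qJ x + qJ y) (qK x + qK y)"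
definition "- x = Quat (- qRe x) (- qI x) (- qJ x) (- qK x)"
definition "x - y = Quat (qRe x - qRe y) (qI x - qI y) (qJ x - qJ y) (qK x - qK y)"
definition "x * y = Quat
  (qRe x * qRe y - qI x * qI y - qJ x * qJ y - qK x * qK y)
  (qRe x * qI y + qI x * qRe y + qJ x * qK y - qK x * qJ y)
  (qRe x * qJ y - qI x * qK y + qJ x * qRe y + qK x * qI y)
  (qRe x * qK y + qI x * qJ y - qJ x * qI y + qK x * qRe y)"

lemmas quat_ring_defs =
  zero_quat_def one_quat_def plus_quat_def uminus_quat_def minus_quat_def times_quat_def

instance
  by standard (simp_all add: quat_ring_defs algebra_simps)

end

lemma quat_sel_simps [simp]:
  "qRe 0 = 0" "qI 0 = 0" "qJ 0 = 0" "qK 0 = 0"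
  "qRe 1 = 1" "qI 1 = 0" "qJ 1 = 0" "qK 1 = 0"
  "qRe (x + y) = qRe x + qRe y" "qI (x + y) = qI x + qI y"
  "qJ (x + y) = qJ x + qJ y" "qK (x + y) = qK x + qK y"
  "qRe (x - y) = qRe x - qRe y" "qI (x - y) = qI x - qI y"
  "qJ (x - y) = qJ x - qJ y" "qK (x - y) = qK x - qK y"
  "qRe (- x) = - qRe x" "qI (- x) = - qI x" "qJ (- x) = - qJ x" "qK (- x) = - qK x"
  "qRe (x * y) = qRe x * qRe y - qI x * qI y - qJ x * qJ y - qK x * qK y"
  "qI (x * y) = qRe x * qI y + qI x * qRe y + qJ x * qK y - qK x * qJ y"
  "qJ (x * y) = qRe x * qJ y - qI x * qK y + qJ x * qRe y + qK x * qI y"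
  "qK (x * y) = qRe x * qK y + qI x * qJ y - qJ x * qI y + qK x * qRe y"
  by (simp_all add: quat_ring_defs)

definition qcnj :: "quat \<Rightarrow> quat"
  where "qcnj x = Quat (qRe x) (- qI x) (- qJ x) (- qK x)"

lemma qcnj_sel [simp]:
  "qRe (qcnj x) = qRe x" "qI (qcnj x) = - qI x" "qJ (qcnj x) = - qJ x" "qK (qcnj x) = - qK x"
  by (simp_all add: qcnj_def)

instantiation quat :: real_algebra_1
begin

definition "r *\<^sub>R x = Quat (r * qRe x) (r * qI x) (r * qJ x) (r * qK x)"

instance
  by standard (simp_all add: scaleR_quat_def quat_eq_iff algebra_simps)

end

lemma quat_scaleR_sel [simp]:
  "qRe (r *\<^sub>R x) = r * qRe x" "qI (r *\<^sub>R x) = r * qI x"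
  "qJ (r *\<^sub>R x) = r * qJ x" "qK (r *\<^sub>R x) = r * qK x"
  by (simp_all add: scaleR_quat_def)

instantiation quat :: real_inner
begin

definition inner_quat_def:
  "inner x y = qRe x * qRe y + qI x * qI y + qJ x * qJ y + qK x * qK (y::quat)"
definition norm_quat_def:
  "norm x = sqrt ((qRe x)\<^sup>2 + (qI x)\<^sup>2 + (qJ x)\<^sup>2 + (qK (x::quat))\<^sup>2)"
definition sgn_quat_def: "sgn x = x /\<^sub>R norm (x::quat)"
definition dist_quat_def: "dist x y = norm (x - (y::quat))"
definition uniformity_quat_def [code del]:
  "(uniformity :: (quat \<times> quat) filter) = (INF e\<in>{0 <..}. principal {(x, y). dist x y < e})"
definition open_quat_def [code del]:
  "open (U :: quat set) \<longleftrightarrow> (\<forall>x\<in>U. eventually (\<lambda>(x', y). x' = x \<longrightarrow> y \<in> U) uniformity)"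

instance
proof
  fix x :: quat
  have "inner x x = 0 \<longleftrightarrow> qRe x = 0 \<and> qI x = 0 \<and> qJ x = 0 \<and> qK x = 0"
    unfolding inner_quat_def by (smt (verit) mult_eq_0_iff zero_le_square)
  then show "inner x x = 0 \<longleftrightarrow> x = 0"
    by (simp add: quat_eq_iff)
qed (simp_all add: inner_quat_def norm_quat_def sgn_quat_def dist_quat_def
      uniformity_quat_def open_quat_def algebra_simps power2_eq_square)

end

instantiation quat :: euclidean_space
begin

definition Basis_quat_def: "Basis = {Quat 1 0 0 0, Quat 0 1 0 0, Quat 0 0 1 0, Quat 0 0 0 1}"

instance
proof
  fix x :: quat
  show "(\<forall>u\<in>Basis. inner x u = 0) \<longleftrightarrow> x = 0"
    by (simp add: Basis_quat_def inner_quat_def) (simp add: quat_eq_iff)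
next
  fix u v :: quat
  assume "u \<in> Basis" "v \<in> Basis"
  then show "inner u v = (if u = v then 1 else 0)"
    unfolding Basis_quat_def by (elim insertE emptyE) (simp_all add: inner_quat_def)
qed (simp_all add: Basis_quat_def)

end

instance quat :: real_normed_algebra_1
proof
  fix x y :: quat
  show "norm (x * y) \<le> norm x * norm y"
    unfolding norm_quat_def real_sqrt_mult [symmetric] quat_sel_simps
    by (intro real_sqrt_le_mono eq_refl) algebra
qed (simp add: norm_quat_def)


section \<open>Right quaternionic Hilbert spaces\<close>

text \<open>
  The real Banach space structure carries addition, norm and topology;
  \<open>qscale\<close> is the right multiplication by quaternions and the inner product is right linear in
  its second argument.  Positive definiteness of the inner product is contained in \<open>norm_eq_sqrt_qinner\<close>,
  since \<open>norm\<close> is positive definite, \<open>qinner x x\<close> is real by \<open>qcnj_qinner\<close>, and \<open>sqrt\<close> is an odd function.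
\<close>

class right_quaternionic_hilbert = banach +
  fixes qscale :: "'a \<Rightarrow> quat \<Rightarrow> 'a"  (infixl \<open>*\<^sub>Q\<close> 75)
    and qinner :: "'a \<Rightarrow> 'a \<Rightarrow> quat"
  assumes qscale_add_left: "(x + y) *\<^sub>Q p = x *\<^sub>Q p + y *\<^sub>Q p"
    and qscale_add_right: "x *\<^sub>Q (p + q) = x *\<^sub>Q p + x *\<^sub>Q q"
    and qscale_qscale: "x *\<^sub>Q p *\<^sub>Q q = x *\<^sub>Q (p * q)"
    and qscale_of_real: "x *\<^sub>Q of_real r = r *\<^sub>R x"
    and qcnj_qinner: "qcnj (qinner x y) = qinner y x"
    and qinner_add_right: "qinner x (y + z) = qinner x y + qinner x z"
    and qinner_qscale_right: "qinner x (y *\<^sub>Q p) = qinner x y * p"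
    and qinner_qscale_left: "qinner (x *\<^sub>Q p) y = qcnj p * qinner x y"
    and norm_eq_sqrt_qinner: "norm x = sqrt (qRe (qinner x x))"
    and separable: "\<exists>S. countable S \<and> (\<forall>x. \<forall>e>0. \<exists>s\<in>S. dist x s < e)"

definition right_subspace :: "'a::right_quaternionic_hilbert set \<Rightarrow> bool"
  where "right_subspace S \<longleftrightarrow>
    0 \<in> S \<and> (\<forall>x\<in>S. \<forall>y\<in>S. x + y \<in> S) \<and> (\<forall>x\<in>S. \<forall>p. x *\<^sub>Q p \<in> S)"

definition closed_right_span :: "'a::right_quaternionic_hilbert set \<Rightarrow> 'a set"
  where "closed_right_span S = closure (right_subspace hull S)"

definition gap :: "'a::right_quaternionic_hilbert set \<Rightarrow> 'a set \<Rightarrow> real"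
  where "gap K L =
    (if K = {0} then 0 else SUP \<phi>\<in>{\<phi>\<in>K. norm \<phi> = 1}. INF \<psi>\<in>L. norm (\<phi> - \<psi>))"

definition orthogonal_projection :: "'a::right_quaternionic_hilbert set \<Rightarrow> 'a \<Rightarrow> 'a"
  where "orthogonal_projection L \<phi> = (THE \<psi>. \<psi> \<in> L \<and> (\<forall>\<theta>\<in>L. qinner \<theta> (\<phi> - \<psi>) = 0))"

text \<open>Isomorphisms of normed right quaternionic spaces: right linear bijections that are continuous
  in both directions.\<close>

definition right_isomorphism_on ::
    "'a::right_quaternionic_hilbert set \<Rightarrow> 'a set \<Rightarrow> ('a \<Rightarrow> 'a) \<Rightarrow> bool"
  where "right_isomorphism_on K L f \<longleftrightarrow>
    (\<forall>x\<in>K. \<forall>y\<in>K. f (x + y) = f x + f y) \<and>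
    (\<forall>x\<in>K. \<forall>p. f (x *\<^sub>Q p) = f x *\<^sub>Q p) \<and>
    (\<exists>g. homeomorphism K L f g)"

text \<open>For a self-adjoint operator the values \<open>qinner \<phi> (A \<phi>)\<close> are real quaternions.\<close>

definition lower_form_bound :: "('a::right_quaternionic_hilbert \<Rightarrow> 'a) \<Rightarrow> real"
  where "lower_form_bound A = (INF \<phi>\<in>{\<phi>. norm \<phi> = 1}. qRe (qinner \<phi> (A \<phi>)))"

definition upper_form_bound :: "('a::right_quaternionic_hilbert \<Rightarrow> 'a) \<Rightarrow> real"
  where "upper_form_bound A = (SUP \<phi>\<in>{\<phi>. norm \<phi> = 1}. qRe (qinner \<phi> (A \<phi>)))"


section \<open>Rank n continuous frames\<close>

text \<open>A family \<open>\<xi> i q\<close> is indexed by \<open>i \<in> {1..n}\<close> and all quaternions \<open>q\<close>.  Weak measurability is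
  what gives meaning to the integrals in the frame inequalities.\<close>

definition weakly_measurable ::
    "nat \<Rightarrow> quat measure \<Rightarrow> (nat \<Rightarrow> quat \<Rightarrow> 'a::right_quaternionic_hilbert) \<Rightarrow> bool"
  where "weakly_measurable n \<mu> \<xi> \<longleftrightarrow>
    (\<forall>i\<in>{1..n}. \<forall>\<phi>. (\<lambda>q. qinner (\<xi> i q) \<phi>) \<in> borel_measurable \<mu>)"

definition continuous_frame ::
    "nat \<Rightarrow> quat measure \<Rightarrow> (nat \<Rightarrow> quat \<Rightarrow> 'a::right_quaternionic_hilbert)
      \<Rightarrow> real \<Rightarrow> real \<Rightarrow> bool"
  where "continuous_frame n \<mu> \<xi> C D \<longleftrightarrow>
    weakly_measurable n \<mu> \<xi> \<and> 0 < C \<and> 0 < D \<and>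
    (\<forall>\<phi>. ennreal (C * (norm \<phi>)\<^sup>2)
            \<le> (\<Sum>i=1..n. \<integral>\<^sup>+ q. ennreal ((norm (qinner (\<xi> i q) \<phi>))\<^sup>2) \<partial>\<mu>) \<and>
         (\<Sum>i=1..n. \<integral>\<^sup>+ q. ennreal ((norm (qinner (\<xi> i q) \<phi>))\<^sup>2) \<partial>\<mu>)
            \<le> ennreal (D * (norm \<phi>)\<^sup>2))"

text \<open>The operator-valued integral is understood weakly: \<open>frame_operator n \<mu> \<eta> \<phi>\<close> is the vector
  whose inner products are obtained by integrating those of \<open>\<eta> i q *\<^sub>Q qinner (\<eta> i q) \<phi>\<close>.\<close>

definition frame_operator ::
    "nat \<Rightarrow> quat measure \<Rightarrow> (nat \<Rightarrow> quat \<Rightarrow> 'a::right_quaternionic_hilbert) \<Rightarrow> 'a \<Rightarrow> 'a"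
  where "frame_operator n \<mu> \<eta> \<phi> =
    (THE \<theta>. \<forall>\<psi>. qinner \<psi> \<theta> = (\<Sum>i=1..n. \<integral>q. qinner \<psi> (\<eta> i q *\<^sub>Q qinner (\<eta> i q) \<phi>) \<partial>\<mu>))"

definition dual_frame ::
    "nat \<Rightarrow> quat measure \<Rightarrow> (nat \<Rightarrow> quat \<Rightarrow> 'a::right_quaternionic_hilbert)
      \<Rightarrow> nat \<Rightarrow> quat \<Rightarrow> 'a"
  where "dual_frame n \<mu> \<eta> i q = inv (frame_operator n \<mu> \<eta>) (\<eta> i q)"

end

theory Submission
  imports Defs
begin

text \<open>
  The lower frame bound makes a frame total, so \<open>L\<close> is the whole space.  Reconstruction gives
  \<open>\<parallel>\<phi>\<parallel>\<^sup>2 = \<Sum>\<^sub>i \<integral> \<langle>\<phi>|A\<^sup>-\<^sup>1 \<eta>\<rangle>\<langle>\<eta>|\<phi>\<rangle>\<close>;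
  writing \<open>\<eta> = \<Psi> + (\<eta> - \<Psi>)\<close> in the last factor bounds the second part by \<open>\<gamma> \<parallel>\<phi>\<parallel>\<^sup>2\<close> and the first one by
  Young's inequality, which yields the lower bound for \<open>\<Psi>\<close>.  Minkowski's inequality yields the upper
  bound.  Then \<open>K\<close> is the whole space too, so the gap is \<open>0\<close> and the projection is the identity.
\<close>

section \<open>Quadratic forms and variational representation\<close>

text \<open>Evaluation at the vertex gives the bound once \<open>0 < c\<close>; the cases
  \<open>c = 0\<close> and \<open>c < 0\<close> are settled by explicit values of \<open>t\<close>.
  Both Cauchy-Schwarz for forms and the estimate for near-minimisers rest on this.\<close>

lemma quadratic_nonneg_discriminant:
  fixes a b c :: real
  assumes nonneg: "\<And>t. 0 \<le> a + 2 * t * b + t\<^sup>2 * c"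
  shows "b\<^sup>2 \<le> a * c"
proof (cases "c = 0")
  case True
  have "b = 0"
  proof (rule ccontr)
    assume "b \<noteq> 0"
    \<comment> \<open>At this \<open>t\<close> the remaining linear function takes the value
      -1.\<close>
    with nonneg[of "- (a + 1) / (2 * b)"] True show False by (simp add: field_simps)
  qed
  with True show ?thesis by simp
next
  case False
  have "0 \<le> c"
  proof (rule ccontr)
    assume "\<not> 0 \<le> c"
    then have neg: "c < 0" by simp
    \<comment> \<open>Chosen so that \<open>t \<ge> 1\<close> and \<open>t\<^sup>2 * c\<close>
      cancels the bound \<open>t * (\<bar>a\<bar> + 2 * \<bar>b\<bar>)\<close> for the lower order
      terms, leaving only \<open>t * c < 0\<close>.\<close>
    define t where "t = 1 + (\<bar>a\<bar> + 2 * \<bar>b\<bar>) / - c"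
    have t: "1 \<le> t" "t * - c = - c + (\<bar>a\<bar> + 2 * \<bar>b\<bar>)"
      using neg by (auto simp: t_def field_simps zero_le_divide_iff divide_le_0_iff)
    have "a + 2 * t * b \<le> t * (\<bar>a\<bar> + 2 * \<bar>b\<bar>)"
    proof -
      have "a \<le> t * \<bar>a\<bar>" using t(1) mult_right_mono[of 1 t "\<bar>a\<bar>"] by simp
      moreover have "t * b \<le> t * \<bar>b\<bar>" using t(1) by (intro mult_left_mono) auto
      ultimately show ?thesis by (simp add: algebra_simps)
    qed
    moreover have "t\<^sup>2 * c = t * c - t * (\<bar>a\<bar> + 2 * \<bar>b\<bar>)"
    proof -
      have "t * (t * - c) = t * (- c + (\<bar>a\<bar> + 2 * \<bar>b\<bar>))" using t(2) by simp
      then show ?thesis by (simp add: power2_eq_square algebra_simps)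
    qed
    moreover have "t * c < 0" using t(1) neg by (simp add: mult_pos_neg)
    ultimately show False using nonneg[of t] by linarith
  qed
  with False have "0 < c" by simp
  \<comment> \<open>The vertex of the parabola, where the value is
    \<open>a - b\<^sup>2 / c\<close>.\<close>
  with nonneg[of "- b / c"] have "0 \<le> a - b\<^sup>2 / c"
    by (simp add: power2_eq_square field_simps)
  with \<open>0 < c\<close> show ?thesis by (simp add: field_simps)
qed

text \<open>The discriminant bound is applied to \<open>t\<close> mapped to
  \<open>a (x + t *\<^sub>R y) (x + t *\<^sub>R y)\<close>. The hypotheses are purely algebraic
  because the result serves to prove boundedness of the inner product and of the frame form.\<close>

lemma symmetric_form_Cauchy_Schwarz:
  fixes a :: "'a::real_vector \<Rightarrow> 'a \<Rightarrow> real"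
  assumes add: "\<And>x y z. a (x + y) z = a x z + a y z"
    and scale: "\<And>r x y. a (r *\<^sub>R x) y = r * a x y"
    and sym: "\<And>x y. a x y = a y x"
    and nonneg: "\<And>x. 0 \<le> a x x"
  shows "\<bar>a x y\<bar> \<le> sqrt (a x x) * sqrt (a y y)"
proof -
  have "0 \<le> a x x + 2 * t * a x y + t\<^sup>2 * a y y" for t
  proof -
    have "a z (x + t *\<^sub>R y) = a z x + t * a z y" for z
      unfolding sym[of z] by (simp add: add scale)
    then have "a (x + t *\<^sub>R y) (x + t *\<^sub>R y) = a x x + 2 * t * a x y + t\<^sup>2 * a y y"
      using sym[of y x] by (simp add: add scale power2_eq_square algebra_simps)
    then show ?thesis using nonneg[of "x + t *\<^sub>R y"] by simp
  qed
  then have "(a x y)\<^sup>2 \<le> a x x * a y y" by (rule quadratic_nonneg_discriminant)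
  then have "sqrt ((a x y)\<^sup>2) \<le> sqrt (a x x * a y y)" by (rule real_sqrt_le_mono)
  then show ?thesis by (simp add: real_sqrt_mult)
qed

text \<open>Minimises \<open>a x x - 2 * f x\<close> over \<open>S\<close>.  An \<open>e\<close>-minimiser \<open>x\<close> satisfies
  \<open>(a v x - f v)\<^sup>2 \<le> e * a v v\<close> for every direction \<open>v\<close>, and this alone makes minimising
  sequences Cauchy.\<close>

lemma coercive_form_representation:
  fixes a :: "'a::banach \<Rightarrow> 'a \<Rightarrow> real" and f :: "'a \<Rightarrow> real"
  assumes "bounded_bilinear a" and sym: "\<And>x y. a x y = a y x"
    and "0 < c" and coercive: "\<And>x. c * (norm x)\<^sup>2 \<le> a x x"
    and "bounded_linear f" and "subspace S" and "closed S"
  shows "\<exists>u\<in>S. \<forall>v\<in>S. a v u = f v"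
proof -
  interpret a: bounded_bilinear a by fact
  interpret f: bounded_linear f by fact
  define J where "J x = a x x - 2 * f x" for x
  obtain B where B: "\<And>x. norm (f x) \<le> norm x * B" using f.bounded by blast
  \<comment> \<open>Completing the square: coercivity beats the linear term, so \<open>J\<close> has
    a finite infimum.\<close>
  have lower: "- (B\<^sup>2 / c) \<le> J x" for x
  proof -
    have "f x \<le> norm x * B" using B[of x] by simp
    moreover have "0 \<le> (c * norm x - B)\<^sup>2 / c" using \<open>0 < c\<close> by simp
    moreover have "(c * norm x - B)\<^sup>2 / c = c * (norm x)\<^sup>2 - 2 * (norm x * B) + B\<^sup>2 / c"
      using \<open>0 < c\<close> by (simp add: power2_eq_square field_simps)
    ultimately show ?thesis using coercive[of x] by (simp add: J_def)
  qed
  then have bdd: "bdd_below (J ` S)" by (auto simp: bdd_below_def)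
  have "S \<noteq> {}" using \<open>subspace S\<close> subspace_0 by blast
  define I where "I = (INF x\<in>S. J x)"
  have "\<exists>x\<in>S. J x < I + 1 / real (Suc k)" for k
    using cINF_less_iff[OF \<open>S \<noteq> {}\<close> bdd, of "I + 1 / real (Suc k)"] by (simp add: I_def)
  then obtain x where x: "\<And>k. x k \<in> S" "\<And>k. J (x k) < I + 1 / real (Suc k)" by metis
  have nearly: "\<bar>a v (x k) - f v\<bar> \<le> sqrt (1 / real (Suc k)) * sqrt (a v v)" if "v \<in> S" for v k
  proof -
    \<comment> \<open>Expanding \<open>J\<close> along the line through \<open>x k\<close> in
      direction \<open>v\<close> gives a quadratic in \<open>t\<close> that cannot fall below
      \<open>I - J (x k)\<close>, hence not below \<open>- 1 / real (Suc k)\<close>.\<close>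
    have "0 \<le> 1 / real (Suc k) + 2 * t * (a v (x k) - f v) + t\<^sup>2 * a v v" for t
    proof -
      have "x k + t *\<^sub>R v \<in> S"
        using x(1) that \<open>subspace S\<close> by (simp add: subspace_add subspace_scale)
      then have "I \<le> J (x k + t *\<^sub>R v)" unfolding I_def by (rule cINF_lower[OF bdd])
      moreover have "J (x k + t *\<^sub>R v) = J (x k) + 2 * t * (a v (x k) - f v) + t\<^sup>2 * a v v"
        by (simp add: J_def a.add_left a.add_right a.scaleR_left a.scaleR_right f.add f.scaleR
            sym[of "x k" v] power2_eq_square algebra_simps)
      ultimately show ?thesis using x(2)[of k] by linarith
    qed
    then have "(a v (x k) - f v)\<^sup>2 \<le> 1 / real (Suc k) * a v v"
      by (rule quadratic_nonneg_discriminant)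
    then have "sqrt ((a v (x k) - f v)\<^sup>2) \<le> sqrt (1 / real (Suc k) * a v v)"
      by (rule real_sqrt_le_mono)
    then show ?thesis by (simp only: real_sqrt_mult real_sqrt_abs)
  qed
  \<comment> \<open>Testing both near-minimisers against their own difference cancels
    \<open>f\<close>: what remains is \<open>a ?v ?v\<close>, from which one factor
    \<open>sqrt (a ?v ?v)\<close> is divided out.\<close>
  have close: "sqrt c * norm (x j - x k) \<le> sqrt (1 / real (Suc j)) + sqrt (1 / real (Suc k))" for j k
  proof -
    let ?v = "x j - x k"
    have "?v \<in> S" using x(1) \<open>subspace S\<close> by (simp add: subspace_diff)
    have le: "sqrt c * norm ?v \<le> sqrt (a ?v ?v)"
      using real_sqrt_le_mono[OF coercive[of ?v]] by (simp add: real_sqrt_mult)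
    have nn: "0 \<le> a ?v ?v" using coercive[of ?v] \<open>0 < c\<close> by (smt (verit) mult_nonneg_nonneg zero_le_power2)
    have "sqrt (a ?v ?v) * sqrt (a ?v ?v) = (a ?v (x j) - f ?v) - (a ?v (x k) - f ?v)"
      using nn by (simp add: a.diff_right)
    also have "\<dots> \<le> (sqrt (1 / real (Suc j)) + sqrt (1 / real (Suc k))) * sqrt (a ?v ?v)"
      using nearly[OF \<open>?v \<in> S\<close>, of j] nearly[OF \<open>?v \<in> S\<close>, of k]
      unfolding distrib_right by linarith
    finally have "sqrt (a ?v ?v) \<le> sqrt (1 / real (Suc j)) + sqrt (1 / real (Suc k))"
      by (smt (verit) mult_right_le_imp_le real_sqrt_ge_zero nn of_nat_0_le_iff zero_le_divide_1_iff)
    with le show ?thesis by linarith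
  qed
  have null: "(\<lambda>k. sqrt (1 / real (Suc k))) \<longlonglongrightarrow> 0"
    using tendsto_real_sqrt[OF LIMSEQ_Suc[OF lim_1_over_n]] by simp
  have "Cauchy x"
  proof (rule metric_CauchyI)
    fix e :: real assume "0 < e"
    then have "0 < sqrt c * e / 2" using \<open>0 < c\<close> by simp
    from order_tendstoD(2)[OF null this] obtain N
      where N: "\<And>k. k \<ge> N \<Longrightarrow> sqrt (1 / real (Suc k)) < sqrt c * e / 2"
      unfolding eventually_sequentially by blast
    have "dist (x j) (x k) < e" if "N \<le> j" "N \<le> k" for j k
    proof -
      have "sqrt c * norm (x j - x k) < sqrt c * e"
        using close[of j k] N[OF that(1)] N[OF that(2)] by linarith
      then show ?thesis using \<open>0 < c\<close> by (simp add: dist_norm)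
    qed
    then show "\<exists>M. \<forall>m\<ge>M. \<forall>n\<ge>M. dist (x m) (x n) < e" by blast
  qed
  then obtain u where u: "x \<longlonglongrightarrow> u" using Cauchy_convergent convergent_def by blast
  have "u \<in> S" using closed_sequentially[OF \<open>closed S\<close>] x(1) u by blast
  moreover have "a v u = f v" if "v \<in> S" for v
  proof -
    have "(\<lambda>k. a v (x k) - f v) \<longlonglongrightarrow> 0"
    proof (rule Lim_null_comparison)
      show "\<forall>\<^sub>F k in sequentially.
          norm (a v (x k) - f v) \<le> sqrt (1 / real (Suc k)) * sqrt (a v v)"
        using nearly[OF that] by (simp only: real_norm_def eventually_True)
      show "(\<lambda>k. sqrt (1 / real (Suc k)) * sqrt (a v v)) \<longlonglongrightarrow> 0"
        by (rule tendsto_mult_left_zero[OF null])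
    qed
    moreover have "(\<lambda>k. a v (x k) - f v) \<longlonglongrightarrow> a v u - f v"
      by (intro tendsto_diff a.tendsto[OF tendsto_const u] tendsto_const)
    ultimately show ?thesis using LIMSEQ_unique by fastforce
  qed
  ultimately show ?thesis by blast
qed

section \<open>Calculus of the quaternionic inner product\<close>

lemma qinner_scaleR_right: "qinner x (r *\<^sub>R y) = r *\<^sub>R qinner x y"
  by (simp add: qscale_of_real[symmetric] qinner_qscale_right of_real_def)

lemma qcnj_add: "qcnj (x + y) = qcnj x + qcnj y"
  and qcnj_scaleR: "qcnj (r *\<^sub>R x) = r *\<^sub>R qcnj x"
  and qcnj_mult: "qcnj (x * y) = qcnj y * qcnj x"
  and norm_qcnj: "norm (qcnj x) = norm x"
  by (simp_all add: quat_eq_iff norm_quat_def)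

lemma bounded_linear_qcnj: "bounded_linear qcnj"
  by (rule bounded_linear_intro[of _ 1]) (simp_all add: qcnj_add qcnj_scaleR norm_qcnj)

lemma bounded_linear_qRe: "bounded_linear qRe"
  by (rule bounded_linear_intro[of _ 1]) (simp_all add: norm_quat_def real_le_rsqrt)

lemma qRe_le_norm: "\<bar>qRe x\<bar> \<le> norm x"
  by (simp add: norm_quat_def real_le_rsqrt)

lemma norm_quat_mult: "norm (x * y) = norm x * norm (y::quat)"
  unfolding norm_quat_def real_sqrt_mult [symmetric] quat_sel_simps
  by (rule arg_cong[of _ _ sqrt]) algebra

text \<open>Taking \<open>p\<close> to be 1, i, j, k reads off the four coordinates. Since
  \<open>qinner (v *\<^sub>Q p) x = qcnj p * qinner v x\<close>, this upgrades identities between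
  real parts, valid for all vectors, to quaternionic ones.\<close>

lemma quat_eqI_qRe:
  assumes "\<And>p. qRe (qcnj p * x) = qRe (qcnj p * y)"
  shows "x = y"
  using assms[of 1] assms[of "Quat 0 1 0 0"] assms[of "Quat 0 0 1 0"] assms[of "Quat 0 0 0 1"]
  by (simp add: quat_eq_iff)

lemma qinner_add_left: "qinner (x + y) z = qinner x z + qinner y z"
  by (metis qcnj_qinner qinner_add_right qcnj_add)

lemma qinner_scaleR_left: "qinner (r *\<^sub>R x) y = r *\<^sub>R qinner x y"
  by (metis qcnj_qinner qinner_scaleR_right qcnj_scaleR)

lemma qinner_diff_right: "qinner x (y - z) = qinner x y - qinner x z"
  using qinner_add_right[of x "y - z" z] by simp

lemma qinner_diff_left: "qinner (x - y) z = qinner x z - qinner y z"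
  using qinner_add_left[of "x - y" y z] by simp

lemma qinner_self: "qinner x x = of_real ((norm x)\<^sup>2)"
proof -
  have im: "qI (qinner x x) = 0" "qJ (qinner x x) = 0" "qK (qinner x x) = 0"
    using qcnj_qinner[of x x] by (simp_all add: quat_eq_iff)
  \<comment> \<open>As \<open>sqrt\<close> is odd, nonnegativity of the norm forces
    \<open>qRe (qinner x x)\<close> itself to be nonnegative.\<close>
  have "0 \<le> sqrt (qRe (qinner x x))" unfolding norm_eq_sqrt_qinner[symmetric] by simp
  then have "qRe (qinner x x) = (norm x)\<^sup>2"
    unfolding norm_eq_sqrt_qinner by simp
  with im show ?thesis by (simp add: quat_eq_iff of_real_def)
qed

lemma qRe_qinner_self: "qRe (qinner x x) = (norm x)\<^sup>2"
  by (simp add: qinner_self of_real_def)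

lemma norm_qscale: "norm (x *\<^sub>Q p) = norm x * norm p"
proof -
  have "qinner (x *\<^sub>Q p) (x *\<^sub>Q p) = (norm x)\<^sup>2 *\<^sub>R (qcnj p * p)"
    by (subst qinner_qscale_left, subst qinner_qscale_right, subst qinner_self)
      (simp add: of_real_def)
  moreover have "qRe (qcnj p * p) = (norm p)\<^sup>2"
    by (simp add: norm_quat_def power2_eq_square)
  ultimately have "(norm (x *\<^sub>Q p))\<^sup>2 = (norm x * norm p)\<^sup>2"
    by (metis power_mult_distrib qRe_qinner_self quat_scaleR_sel(1))
  then show ?thesis by (simp add: power2_eq_iff_nonneg)
qed

lemma qRe_qinner_commute: "qRe (qinner x y) = qRe (qinner y x)"
  by (metis qcnj_qinner qcnj_sel(1))

text \<open>Rotating \<open>x\<close> by \<open>p = qinner x y\<close> makes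
  \<open>qinner (x *\<^sub>Q p) y\<close> the real number \<open>(norm p)\<^sup>2\<close>. The
  inequality for the real symmetric form then applies, and one factor \<open>norm p\<close>
  cancels.\<close>

lemma qinner_Cauchy_Schwarz: "norm (qinner x y) \<le> norm x * norm y"
proof (cases "qinner x y = 0")
  case False
  let ?p = "qinner x y"
  have "qRe (qcnj ?p * ?p) = (norm ?p)\<^sup>2"
    by (simp add: norm_quat_def power2_eq_square)
  then have "norm ?p * norm ?p = qRe (qinner (x *\<^sub>Q ?p) y)"
    by (simp add: qinner_qscale_left power2_eq_square)
  also have "\<dots> \<le> \<bar>qRe (qinner (x *\<^sub>Q ?p) y)\<bar>" by simp
  also have "\<dots> \<le> sqrt (qRe (qinner (x *\<^sub>Q ?p) (x *\<^sub>Q ?p))) * sqrt (qRe (qinner y y))"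
    by (rule symmetric_form_Cauchy_Schwarz)
      (simp_all add: qinner_add_left qinner_scaleR_left qRe_qinner_self, rule qRe_qinner_commute)
  also have "\<dots> = norm ?p * (norm x * norm y)"
    by (simp add: qRe_qinner_self norm_qscale)
  finally show ?thesis using False by simp
qed simp

lemma bounded_bilinear_qRe_qinner:
  "bounded_bilinear (\<lambda>x y :: 'a::right_quaternionic_hilbert. qRe (qinner x y))"
proof
  show "\<exists>K. \<forall>a b :: 'a. norm (qRe (qinner a b)) \<le> norm a * norm b * K"
    by (intro exI[of _ 1] allI)
      (simp, rule order_trans[OF qRe_le_norm qinner_Cauchy_Schwarz])
qed (simp_all add: qinner_add_left qinner_add_right qinner_scaleR_left qinner_scaleR_right)

lemma qinner_eqI:
  assumes "\<And>v. qRe (qinner v x) = qRe (qinner v y)"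
  shows "x = y"
proof -
  have "qRe (qinner (x - y) (x - y)) = 0" using assms[of "x - y"] by (simp add: qinner_diff_right)
  then show ?thesis by (simp add: qRe_qinner_self)
qed

section \<open>Weighted integral inequalities\<close>

text \<open>The pointwise bound rearranges \<open>0 \<le> (t * x - y)\<^sup>2\<close>. The free
  weight \<open>t\<close> takes the place of an L2 Cauchy-Schwarz inequality: a good choice of it
  recovers the sharp constant.\<close>

lemma sum_nn_integral_Young:
  fixes f g :: "'i \<Rightarrow> 'b \<Rightarrow> real"
  assumes [measurable]: "\<And>i. i \<in> I \<Longrightarrow> f i \<in> borel_measurable M" "\<And>i. i \<in> I \<Longrightarrow> g i \<in> borel_measurable M"
    and "0 < t"
  shows "(\<Sum>i\<in>I. \<integral>\<^sup>+ q. ennreal (f i q * g i q) \<partial>M)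
    \<le> ennreal (t / 2) * (\<Sum>i\<in>I. \<integral>\<^sup>+ q. ennreal ((f i q)\<^sup>2) \<partial>M)
      + ennreal (1 / (2 * t)) * (\<Sum>i\<in>I. \<integral>\<^sup>+ q. ennreal ((g i q)\<^sup>2) \<partial>M)"
  unfolding sum_distrib_left sum.distrib[symmetric]
proof (rule sum_mono)
  fix i assume [simp]: "i \<in> I"
  have pt: "x * y \<le> t / 2 * x\<^sup>2 + 1 / (2 * t) * y\<^sup>2" for x y :: real
  proof -
    have "0 \<le> (t * x - y)\<^sup>2 / (2 * t)" using \<open>0 < t\<close> by simp
    then show ?thesis using \<open>0 < t\<close> by (simp add: power2_eq_square field_simps)
  qed
  have "(\<integral>\<^sup>+ q. ennreal (f i q * g i q) \<partial>M)
      \<le> (\<integral>\<^sup>+ q. ennreal (t / 2) * ennreal ((f i q)\<^sup>2) + ennreal (1 / (2 * t)) * ennreal ((g i q)\<^sup>2) \<partial>M)"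
    using \<open>0 < t\<close> pt
    by (intro nn_integral_mono) (simp add: ennreal_mult[symmetric] ennreal_plus[symmetric] ennreal_leI del: ennreal_plus)
  also have "\<dots> = ennreal (t / 2) * (\<integral>\<^sup>+ q. ennreal ((f i q)\<^sup>2) \<partial>M)
      + ennreal (1 / (2 * t)) * (\<integral>\<^sup>+ q. ennreal ((g i q)\<^sup>2) \<partial>M)"
    by (simp add: nn_integral_add nn_integral_cmult)
  finally show "(\<integral>\<^sup>+ q. ennreal (f i q * g i q) \<partial>M)
      \<le> ennreal (t / 2) * (\<integral>\<^sup>+ q. ennreal ((f i q)\<^sup>2) \<partial>M)
      + ennreal (1 / (2 * t)) * (\<integral>\<^sup>+ q. ennreal ((g i q)\<^sup>2) \<partial>M)" .
qed

text \<open>The same square, now bounding the cross term \<open>2 * x * y\<close>. Optimising over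
  \<open>t\<close> turns this into Minkowski's inequality for the squared L2 norm.\<close>

lemma sum_nn_integral_add_square_le:
  fixes f g :: "'i \<Rightarrow> 'b \<Rightarrow> real"
  assumes [measurable]: "\<And>i. i \<in> I \<Longrightarrow> f i \<in> borel_measurable M" "\<And>i. i \<in> I \<Longrightarrow> g i \<in> borel_measurable M"
    and "0 < t"
  shows "(\<Sum>i\<in>I. \<integral>\<^sup>+ q. ennreal ((f i q + g i q)\<^sup>2) \<partial>M)
    \<le> ennreal (1 + t) * (\<Sum>i\<in>I. \<integral>\<^sup>+ q. ennreal ((f i q)\<^sup>2) \<partial>M)
      + ennreal (1 + 1 / t) * (\<Sum>i\<in>I. \<integral>\<^sup>+ q. ennreal ((g i q)\<^sup>2) \<partial>M)"
  unfolding sum_distrib_left sum.distrib[symmetric]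
proof (rule sum_mono)
  fix i assume [simp]: "i \<in> I"
  have pt: "(x + y)\<^sup>2 \<le> (1 + t) * x\<^sup>2 + (1 + 1 / t) * y\<^sup>2" for x y :: real
  proof -
    have "0 \<le> (t * x - y)\<^sup>2 / t" using \<open>0 < t\<close> by simp
    then show ?thesis using \<open>0 < t\<close> by (simp add: power2_eq_square field_simps)
  qed
  have "(\<integral>\<^sup>+ q. ennreal ((f i q + g i q)\<^sup>2) \<partial>M)
      \<le> (\<integral>\<^sup>+ q. ennreal (1 + t) * ennreal ((f i q)\<^sup>2) + ennreal (1 + 1 / t) * ennreal ((g i q)\<^sup>2) \<partial>M)"
    using \<open>0 < t\<close> pt
    by (intro nn_integral_mono) (simp add: ennreal_mult[symmetric] ennreal_plus[symmetric] ennreal_leI del: ennreal_plus)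
  also have "\<dots> = ennreal (1 + t) * (\<integral>\<^sup>+ q. ennreal ((f i q)\<^sup>2) \<partial>M)
      + ennreal (1 + 1 / t) * (\<integral>\<^sup>+ q. ennreal ((g i q)\<^sup>2) \<partial>M)"
    by (simp add: nn_integral_add nn_integral_cmult)
  finally show "(\<integral>\<^sup>+ q. ennreal ((f i q + g i q)\<^sup>2) \<partial>M)
      \<le> ennreal (1 + t) * (\<integral>\<^sup>+ q. ennreal ((f i q)\<^sup>2) \<partial>M)
      + ennreal (1 + 1 / t) * (\<integral>\<^sup>+ q. ennreal ((g i q)\<^sup>2) \<partial>M)" .
qed

section \<open>Frame sums and totality\<close>

definition frame_sum ::
    "nat \<Rightarrow> quat measure \<Rightarrow> (nat \<Rightarrow> quat \<Rightarrow> 'a::right_quaternionic_hilbert) \<Rightarrow> 'a \<Rightarrow> ennreal"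
  where "frame_sum n \<mu> \<xi> \<phi> = (\<Sum>i=1..n. \<integral>\<^sup>+ q. ennreal ((norm (qinner (\<xi> i q) \<phi>))\<^sup>2) \<partial>\<mu>)"

text \<open>The sesquilinear form that the frame operator has to represent, available before the
  description defining that operator is known to pick out a vector.\<close>

definition frame_form ::
    "nat \<Rightarrow> quat measure \<Rightarrow> (nat \<Rightarrow> quat \<Rightarrow> 'a::right_quaternionic_hilbert) \<Rightarrow> 'a \<Rightarrow> 'a \<Rightarrow> quat"
  where "frame_form n \<mu> \<eta> \<psi> \<phi> = (\<Sum>i=1..n. \<integral>q. qinner \<psi> (\<eta> i q *\<^sub>Q qinner (\<eta> i q) \<phi>) \<partial>\<mu>)"

lemma continuous_frame_iff:
  "continuous_frame n \<mu> \<xi> C D \<longleftrightarrow> weakly_measurable n \<mu> \<xi> \<and> 0 < C \<and> 0 < D \<and>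
    (\<forall>\<phi>. ennreal (C * (norm \<phi>)\<^sup>2) \<le> frame_sum n \<mu> \<xi> \<phi> \<and>
         frame_sum n \<mu> \<xi> \<phi> \<le> ennreal (D * (norm \<phi>)\<^sup>2))"
  by (simp add: continuous_frame_def frame_sum_def)

lemma measurable_qinner:
  "weakly_measurable n \<mu> \<xi> \<Longrightarrow> i \<in> {1..n} \<Longrightarrow> (\<lambda>q. qinner (\<xi> i q) \<phi>) \<in> borel_measurable \<mu>"
  by (simp add: weakly_measurable_def)

lemma frame_sum_scaleR:
  assumes "weakly_measurable n \<mu> \<xi>"
  shows "frame_sum n \<mu> \<xi> (r *\<^sub>R \<phi>) = ennreal (r\<^sup>2) * frame_sum n \<mu> \<xi> \<phi>"
  unfolding frame_sum_def sum_distrib_left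
proof (rule sum.cong[OF refl])
  fix i assume "i \<in> {1..n}"
  note [measurable] = measurable_qinner[OF assms this]
  show "(\<integral>\<^sup>+ q. ennreal ((norm (qinner (\<xi> i q) (r *\<^sub>R \<phi>)))\<^sup>2) \<partial>\<mu>)
      = ennreal (r\<^sup>2) * (\<integral>\<^sup>+ q. ennreal ((norm (qinner (\<xi> i q) \<phi>))\<^sup>2) \<partial>\<mu>)"
    by (simp add: qinner_scaleR_right power_mult_distrib ennreal_mult nn_integral_cmult)
qed

text \<open>Normalising the vector avoids pulling \<open>(norm \<phi>)\<^sup>2\<close> out of a nonnegative integral such as
  \<open>\<integral>\<^sup>+ q. (norm (\<eta> i q - \<Psi> i q) * norm \<phi>)\<^sup>2 \<partial>\<mu>\<close>, whose integrand is not known to be measurable.\<close>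

lemma continuous_frameI_unit:
  fixes \<xi> :: "nat \<Rightarrow> quat \<Rightarrow> 'a::right_quaternionic_hilbert"
  assumes meas: "weakly_measurable n \<mu> \<xi>" and "0 < C" "0 < D"
    and unit: "\<And>\<phi>. norm \<phi> = 1 \<Longrightarrow> ennreal C \<le> frame_sum n \<mu> \<xi> \<phi> \<and> frame_sum n \<mu> \<xi> \<phi> \<le> ennreal D"
  shows "continuous_frame n \<mu> \<xi> C D"
  unfolding continuous_frame_iff
proof (intro conjI allI assms(1-3))
  fix \<phi> :: 'a
  \<comment> \<open>The value 0 at the zero vector keeps
    \<open>\<phi> = norm \<phi> *\<^sub>R u\<close> true in every case.\<close>
  define u where "u = (if \<phi> = 0 then 0 else inverse (norm \<phi>) *\<^sub>R \<phi>)"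
  have \<phi>: "\<phi> = norm \<phi> *\<^sub>R u" by (simp add: u_def)
  have fs: "frame_sum n \<mu> \<xi> \<phi> = ennreal ((norm \<phi>)\<^sup>2) * frame_sum n \<mu> \<xi> u"
    by (subst \<phi>) (rule frame_sum_scaleR[OF meas])
  show "ennreal (C * (norm \<phi>)\<^sup>2) \<le> frame_sum n \<mu> \<xi> \<phi>"
  proof (cases "\<phi> = 0")
    case False
    then have "norm u = 1" by (simp add: u_def)
    with unit have "ennreal C \<le> frame_sum n \<mu> \<xi> u" by blast
    then show ?thesis
      unfolding fs using \<open>0 < C\<close> by (simp add: ennreal_mult mult.commute[of _ "ennreal ((norm \<phi>)\<^sup>2)"] mult_left_mono)
  qed simp
  show "frame_sum n \<mu> \<xi> \<phi> \<le> ennreal (D * (norm \<phi>)\<^sup>2)"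
  proof (cases "\<phi> = 0")
    case False
    then have "norm u = 1" by (simp add: u_def)
    with unit have "frame_sum n \<mu> \<xi> u \<le> ennreal D" by blast
    then show ?thesis
      unfolding fs using \<open>0 < D\<close> by (simp add: ennreal_mult mult.commute[of _ "ennreal ((norm \<phi>)\<^sup>2)"] mult_left_mono)
  qed (use frame_sum_scaleR[OF meas, of 0 0] in simp)
qed

text \<open>Vanishing coefficients make the frame sum 0, and the lower bound with
  \<open>0 < C\<close> leaves only the zero vector. This totality is what makes the span of a frame
  dense.\<close>

lemma continuous_frame_eq_0:
  assumes "continuous_frame n \<mu> \<xi> C D" and "\<And>i q. i \<in> {1..n} \<Longrightarrow> qinner (\<xi> i q) \<phi> = 0"
  shows "\<phi> = 0"
proof -
  have "frame_sum n \<mu> \<xi> \<phi> = 0" unfolding frame_sum_def using assms(2) by simp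
  with assms(1) have "ennreal (C * (norm \<phi>)\<^sup>2) \<le> 0" "0 < C"
    unfolding continuous_frame_iff by metis+
  then have "C * (norm \<phi>)\<^sup>2 \<le> 0" by (simp add: ennreal_eq_0_iff)
  with \<open>0 < C\<close> show ?thesis by (simp add: mult_le_0_iff)
qed

section \<open>Closed right spans\<close>

lemma right_subspace_hull: "right_subspace (right_subspace hull S)"
  by (rule hull_in) (auto simp: right_subspace_def)

lemma right_subspace_imp_subspace: "right_subspace S \<Longrightarrow> subspace S"
  unfolding right_subspace_def subspace_def by (metis qscale_of_real)

lemma subspace_closure:
  fixes S :: "'a::real_normed_vector set"
  assumes "subspace S" shows "subspace (closure S)"
  unfolding subspace_def
proof (intro conjI ballI allI)
  show "0 \<in> closure S" using assms closure_subset subspace_0 by blast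
  fix x assume "x \<in> closure S"
  then obtain f where f: "\<And>k. f k \<in> S" "f \<longlonglongrightarrow> x" unfolding closure_sequential by blast
  show "r *\<^sub>R x \<in> closure S" for r
    unfolding closure_sequential
    by (rule exI[of _ "\<lambda>k. r *\<^sub>R f k"]) (use f assms in \<open>auto intro: tendsto_intros simp: subspace_scale\<close>)
  fix y assume "y \<in> closure S"
  then obtain g where g: "\<And>k. g k \<in> S" "g \<longlonglongrightarrow> y" unfolding closure_sequential by blast
  show "x + y \<in> closure S"
    unfolding closure_sequential
    by (rule exI[of _ "\<lambda>k. f k + g k"]) (use f g assms in \<open>auto intro: tendsto_intros simp: subspace_add\<close>)
qed

text \<open>The representation lemma, with the real inner product as form, yields the orthogonal
  projection \<open>u\<close> of \<open>x\<close> onto the closed span. Then \<open>x - u\<close> is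
  orthogonal to \<open>S\<close>, so totality gives \<open>x = u\<close>.\<close>

lemma closed_right_span_eq_UNIV:
  fixes S :: "'a::right_quaternionic_hilbert set"
  assumes total: "\<And>\<phi>. (\<And>s. s \<in> S \<Longrightarrow> qinner s \<phi> = 0) \<Longrightarrow> \<phi> = 0"
  shows "closed_right_span S = UNIV"
proof -
  let ?H = "right_subspace hull S"
  have sub: "subspace (closed_right_span S)"
    unfolding closed_right_span_def
    by (intro subspace_closure right_subspace_imp_subspace right_subspace_hull)
  have "x \<in> closed_right_span S" for x :: 'a
  proof -
    have "bounded_linear (\<lambda>v. qRe (qinner v x))"
      by (rule bounded_bilinear.bounded_linear_left[OF bounded_bilinear_qRe_qinner])
    then obtain u where u: "u \<in> closed_right_span S"
        "\<And>v. v \<in> closed_right_span S \<Longrightarrow> qRe (qinner v u) = qRe (qinner v x)"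
      using coercive_form_representation[OF bounded_bilinear_qRe_qinner qRe_qinner_commute zero_less_one _ _ sub,
          of "\<lambda>v. qRe (qinner v x)"]
      by (auto simp: qRe_qinner_self closed_right_span_def simp del: mult_1)
    have "qinner s (x - u) = 0" if "s \<in> S" for s
    proof (rule quat_eqI_qRe)
      fix p
      \<comment> \<open>All right multiples of \<open>s\<close> lie in the hull, so real
        orthogonality to them amounts to quaternionic orthogonality to \<open>s\<close>.\<close>
      have "s *\<^sub>Q p \<in> ?H"
        using right_subspace_hull[of S] hull_inc[OF that] by (simp add: right_subspace_def)
      then have "s *\<^sub>Q p \<in> closed_right_span S"
        unfolding closed_right_span_def using closure_subset by blast
      from u(2)[OF this] show "qRe (qcnj p * qinner s (x - u)) = qRe (qcnj p * 0)"
        unfolding qinner_qscale_left qinner_diff_right right_diff_distrib by simp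
    qed
    then have "x - u = 0" by (rule total)
    with u(1) show ?thesis by simp
  qed
  then show ?thesis by blast
qed

lemma continuous_frame_span:
  assumes "continuous_frame n \<mu> \<xi> C D"
  shows "closed_right_span {\<xi> i q | i q. i \<in> {1..n}} = UNIV"
  by (rule closed_right_span_eq_UNIV) (rule continuous_frame_eq_0[OF assms], blast)

section \<open>The frame form and the frame operator\<close>

text \<open>Young's inequality bounds the product of two coefficients by their squares, whose
  integrals are finite by the upper frame bound. Thus the integrals in \<open>frame_form\<close> are
  genuine and not the default value 0 of a nonintegrable function.\<close>

lemma frame_integrable:
  assumes "continuous_frame n \<mu> \<eta> C D" and i: "i \<in> {1..n}"
  shows "integrable \<mu> (\<lambda>q. qinner \<psi> (\<eta> i q *\<^sub>Q qinner (\<eta> i q) \<phi>))"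
proof -
  have wm: "weakly_measurable n \<mu> \<eta>" using assms(1) by (simp add: continuous_frame_iff)
  note [measurable] = measurable_qinner[OF wm i]
  have eq: "qinner \<psi> (\<eta> i q *\<^sub>Q qinner (\<eta> i q) \<phi>) = qcnj (qinner (\<eta> i q) \<psi>) * qinner (\<eta> i q) \<phi>" for q
    by (simp add: qinner_qscale_right qcnj_qinner)
  have [measurable]: "qcnj \<in> borel_measurable borel"
    by (intro borel_measurable_continuous_onI linear_continuous_on bounded_linear_qcnj)
  have fin: "(\<integral>\<^sup>+ q. ennreal ((norm (qinner (\<eta> i q) \<phi>'))\<^sup>2) \<partial>\<mu>) < \<infinity>" for \<phi>'
  proof -
    have "(\<integral>\<^sup>+ q. ennreal ((norm (qinner (\<eta> i q) \<phi>'))\<^sup>2) \<partial>\<mu>) \<le> frame_sum n \<mu> \<eta> \<phi>'"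
      unfolding frame_sum_def by (rule member_le_sum) (use i in auto)
    also have "\<dots> \<le> ennreal (D * (norm \<phi>')\<^sup>2)" using assms(1) by (simp add: continuous_frame_iff)
    finally show ?thesis by (simp add: order_le_less_trans)
  qed
  have "(\<integral>\<^sup>+ q. ennreal (norm (qcnj (qinner (\<eta> i q) \<psi>) * qinner (\<eta> i q) \<phi>)) \<partial>\<mu>)
      = (\<Sum>j\<in>{i}. \<integral>\<^sup>+ q. ennreal (norm (qinner (\<eta> j q) \<psi>) * norm (qinner (\<eta> j q) \<phi>)) \<partial>\<mu>)"
    by (simp add: norm_quat_mult norm_qcnj)
  also have "\<dots> < \<infinity>"
    by (rule order_le_less_trans[OF sum_nn_integral_Young[where t = 1]])
      (use fin ennreal_less_top[of "1 / 2"] in \<open>auto simp: ennreal_mult_less_top\<close>)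
  finally show ?thesis unfolding eq by (intro integrableI_bounded) simp_all
qed

lemma frame_form_add_left:
  assumes "continuous_frame n \<mu> \<eta> C D"
  shows "frame_form n \<mu> \<eta> (x + y) \<phi> = frame_form n \<mu> \<eta> x \<phi> + frame_form n \<mu> \<eta> y \<phi>"
  using frame_integrable[OF assms]
  by (simp add: frame_form_def qinner_add_left sum.distrib)

lemma frame_form_qscale_left:
  assumes "continuous_frame n \<mu> \<eta> C D"
  shows "frame_form n \<mu> \<eta> (x *\<^sub>Q p) \<phi> = qcnj p * frame_form n \<mu> \<eta> x \<phi>"
  unfolding frame_form_def sum_distrib_left
  by (rule sum.cong[OF refl]) (simp add: qinner_qscale_left
      integral_bounded_linear[OF bounded_linear_mult_right] frame_integrable[OF assms])

lemma frame_form_scaleR_left: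
  assumes "continuous_frame n \<mu> \<eta> C D"
  shows "frame_form n \<mu> \<eta> (r *\<^sub>R x) \<phi> = r *\<^sub>R frame_form n \<mu> \<eta> x \<phi>"
proof -
  have "qcnj (of_real r) = of_real r" by (simp add: of_real_def quat_eq_iff)
  with frame_form_qscale_left[OF assms, of x "of_real r"] show ?thesis
    by (simp add: qscale_of_real scaleR_conv_of_real)
qed

text \<open>Conjugating the integrand swaps the two vectors, and conjugation is bounded linear, so
  it commutes with sum and integral. This is the self-adjointness of the frame operator at the level
  of forms.\<close>

lemma qcnj_frame_form:
  assumes "continuous_frame n \<mu> \<eta> C D"
  shows "qcnj (frame_form n \<mu> \<eta> \<psi> \<phi>) = frame_form n \<mu> \<eta> \<phi> \<psi>"
proof -
  have cnj: "qcnj (qinner \<psi> (\<eta> i q *\<^sub>Q qinner (\<eta> i q) \<phi>)) = qinner \<phi> (\<eta> i q *\<^sub>Q qinner (\<eta> i q) \<psi>)" for i q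
    by (simp add: qinner_qscale_right qcnj_mult qcnj_qinner)
  have "qcnj (frame_form n \<mu> \<eta> \<psi> \<phi>)
      = (\<Sum>i=1..n. qcnj (\<integral>q. qinner \<psi> (\<eta> i q *\<^sub>Q qinner (\<eta> i q) \<phi>) \<partial>\<mu>))"
    unfolding frame_form_def by (rule linear_sum[OF bounded_linear.linear[OF bounded_linear_qcnj]])
  also have "\<dots> = frame_form n \<mu> \<eta> \<phi> \<psi>"
    unfolding frame_form_def
    by (rule sum.cong[OF refl])
      (subst integral_bounded_linear[OF bounded_linear_qcnj frame_integrable[OF assms], symmetric], simp_all add: cnj)
  finally show ?thesis .
qed

lemma qRe_frame_form_commute:
  assumes "continuous_frame n \<mu> \<eta> C D"
  shows "qRe (frame_form n \<mu> \<eta> \<psi> \<phi>) = qRe (frame_form n \<mu> \<eta> \<phi> \<psi>)"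
  by (metis qcnj_frame_form[OF assms] qcnj_sel(1))

text \<open>On the diagonal the integrand has real part
  \<open>(norm (qinner (\<eta> i q) \<phi>))\<^sup>2\<close>. This links the extended nonnegative
  frame sum to the quaternion-valued form, so that the frame bounds become coercivity and
  boundedness.\<close>

lemma frame_form_diagonal:
  assumes "continuous_frame n \<mu> \<eta> C D"
  shows "frame_sum n \<mu> \<eta> \<phi> = ennreal (qRe (frame_form n \<mu> \<eta> \<phi> \<phi>))"
    and "0 \<le> qRe (frame_form n \<mu> \<eta> \<phi> \<phi>)"
proof -
  have eq: "qRe (qinner \<phi> (\<eta> i q *\<^sub>Q qinner (\<eta> i q) \<phi>)) = (norm (qinner (\<eta> i q) \<phi>))\<^sup>2" for i q
    unfolding qinner_qscale_right qcnj_qinner[of "\<eta> i q" \<phi>, symmetric]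
    by (simp add: norm_quat_def power2_eq_square)
  have int: "integrable \<mu> (\<lambda>q. (norm (qinner (\<eta> i q) \<phi>))\<^sup>2)" if "i \<in> {1..n}" for i
    using integrable_bounded_linear[OF bounded_linear_qRe frame_integrable[OF assms that, of \<phi> \<phi>]] by (simp only: eq)
  have form: "qRe (frame_form n \<mu> \<eta> \<phi> \<phi>) = (\<Sum>i=1..n. \<integral>q. (norm (qinner (\<eta> i q) \<phi>))\<^sup>2 \<partial>\<mu>)"
    unfolding frame_form_def linear_sum[OF bounded_linear.linear[OF bounded_linear_qRe]]
    by (rule sum.cong[OF refl])
      (subst integral_bounded_linear[OF bounded_linear_qRe frame_integrable[OF assms], symmetric], simp_all only: eq)
  show "0 \<le> qRe (frame_form n \<mu> \<eta> \<phi> \<phi>)" unfolding form by (intro sum_nonneg integral_nonneg) simp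
  show "frame_sum n \<mu> \<eta> \<phi> = ennreal (qRe (frame_form n \<mu> \<eta> \<phi> \<phi>))"
    unfolding form frame_sum_def
    by (subst sum_ennreal[symmetric], simp) (simp add: nn_integral_eq_integral int)
qed

lemma frame_form_bounds:
  assumes frame: "continuous_frame n \<mu> \<eta> C D"
  shows "C * (norm \<phi>)\<^sup>2 \<le> qRe (frame_form n \<mu> \<eta> \<phi> \<phi>)"
    and "qRe (frame_form n \<mu> \<eta> \<phi> \<phi>) \<le> D * (norm \<phi>)\<^sup>2"
  using frame frame_form_diagonal[OF frame, of \<phi>]
  by (auto simp: continuous_frame_iff dest!: spec[of _ \<phi>])

text \<open>Cauchy-Schwarz for the form reduces the estimate to the diagonal, where the upper frame
  bound gives the constant \<open>D\<close>.\<close>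

lemma bounded_bilinear_frame_form:
  fixes \<eta> :: "nat \<Rightarrow> quat \<Rightarrow> 'a::right_quaternionic_hilbert"
  assumes frame: "continuous_frame n \<mu> \<eta> C D"
  shows "bounded_bilinear (\<lambda>x y. qRe (frame_form n \<mu> \<eta> x y))"
proof
  let ?a = "\<lambda>x y. qRe (frame_form n \<mu> \<eta> x y)"
  have add: "?a (x + y) z = ?a x z + ?a y z" for x y z
    by (simp add: frame_form_add_left[OF frame])
  have scale: "?a (r *\<^sub>R x) y = r * ?a x y" for r x y
    by (simp add: frame_form_scaleR_left[OF frame])
  note sym = qRe_frame_form_commute[OF frame]
  show "?a (x + y) z = ?a x z + ?a y z" for x y z by (rule add)
  show "?a z (x + y) = ?a z x + ?a z y" for x y z using add[of x y z] by (simp only: sym[of z])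
  show "?a (r *\<^sub>R x) y = r *\<^sub>R ?a x y" for r x y by (simp only: scale real_scaleR_def)
  show "?a y (r *\<^sub>R x) = r *\<^sub>R ?a y x" for r x y
    using scale[of r x y] by (simp only: sym[of y] real_scaleR_def)
  have "0 < D" using frame by (simp add: continuous_frame_iff)
  show "\<exists>K. \<forall>x y. norm (?a x y) \<le> norm x * norm y * K"
  proof (intro exI[of _ D] allI)
    fix x y
    have diag: "sqrt (?a z z) \<le> sqrt D * norm z" for z
      using real_sqrt_le_mono[OF frame_form_bounds(2)[OF frame, of z]] by (simp add: real_sqrt_mult)
    have "\<bar>?a x y\<bar> \<le> sqrt (?a x x) * sqrt (?a y y)"
      by (rule symmetric_form_Cauchy_Schwarz[of ?a, OF add scale sym frame_form_diagonal(2)[OF frame]])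
    also have "\<dots> \<le> (sqrt D * norm x) * (sqrt D * norm y)"
      using \<open>0 < D\<close> by (intro mult_mono diag) (simp_all add: frame_form_diagonal(2)[OF frame])
    also have "\<dots> = norm x * norm y * D"
      using \<open>0 < D\<close> by (simp add: field_simps)
    finally show "norm (?a x y) \<le> norm x * norm y * D" by simp
  qed
qed

text \<open>Riesz representation supplies a vector for the description in
  \<open>frame_operator\<close>, and definiteness of the inner product makes it unique.\<close>

lemma qinner_frame_operator:
  fixes \<eta> :: "nat \<Rightarrow> quat \<Rightarrow> 'a::right_quaternionic_hilbert"
  assumes frame: "continuous_frame n \<mu> \<eta> C D"
  shows "qinner \<psi> (frame_operator n \<mu> \<eta> \<phi>) = frame_form n \<mu> \<eta> \<psi> \<phi>"
proof -
  have "bounded_linear (\<lambda>v. qRe (frame_form n \<mu> \<eta> v \<phi>))"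
    by (rule bounded_bilinear.bounded_linear_left[OF bounded_bilinear_frame_form[OF frame]])
  \<comment> \<open>The form is the real inner product, coercive with constant 1, on the whole
    space.\<close>
  then obtain \<theta> where \<theta>: "\<And>v. qRe (qinner v \<theta>) = qRe (frame_form n \<mu> \<eta> v \<phi>)"
    using coercive_form_representation[OF bounded_bilinear_qRe_qinner qRe_qinner_commute zero_less_one _ _ subspace_UNIV closed_UNIV,
        of "\<lambda>v. qRe (frame_form n \<mu> \<eta> v \<phi>)"]
    by (auto simp: qRe_qinner_self)
  have "qinner v \<theta> = frame_form n \<mu> \<eta> v \<phi>" for v
  proof (rule quat_eqI_qRe)
    show "qRe (qcnj p * qinner v \<theta>) = qRe (qcnj p * frame_form n \<mu> \<eta> v \<phi>)" for p
      using \<theta>[of "v *\<^sub>Q p"] by (simp only: qinner_qscale_left frame_form_qscale_left[OF frame])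
  qed
  then have "\<forall>\<psi>. qinner \<psi> \<theta> = (\<Sum>i=1..n. \<integral>q. qinner \<psi> (\<eta> i q *\<^sub>Q qinner (\<eta> i q) \<phi>) \<partial>\<mu>)"
    by (simp add: frame_form_def)
  moreover from this have "frame_operator n \<mu> \<eta> \<phi> = \<theta>"
    unfolding frame_operator_def by (intro the_equality qinner_eqI) simp_all
  ultimately show ?thesis by (simp add: frame_form_def)
qed

text \<open>A Lax-Milgram argument: the frame form is coercive with the lower frame bound as
  constant, so every \<open>y\<close> is represented through it. Surjectivity makes
  \<open>inv\<close> in \<open>dual_frame\<close> a right inverse of the frame operator.\<close>

lemma surj_frame_operator:
  fixes \<eta> :: "nat \<Rightarrow> quat \<Rightarrow> 'a::right_quaternionic_hilbert"
  assumes frame: "continuous_frame n \<mu> \<eta> C D"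
  shows "surj (frame_operator n \<mu> \<eta>)"
proof (rule surjI)
  have "\<exists>x. frame_operator n \<mu> \<eta> x = y" for y
  proof -
    have "0 < C" using frame by (simp add: continuous_frame_iff)
    have "bounded_linear (\<lambda>v. qRe (qinner v y))"
      by (rule bounded_bilinear.bounded_linear_left[OF bounded_bilinear_qRe_qinner])
    then obtain x where "\<And>v. qRe (frame_form n \<mu> \<eta> v x) = qRe (qinner v y)"
      using coercive_form_representation[OF bounded_bilinear_frame_form[OF frame] qRe_frame_form_commute[OF frame]
          \<open>0 < C\<close> frame_form_bounds(1)[OF frame] _ subspace_UNIV closed_UNIV, of "\<lambda>v. qRe (qinner v y)"]
      by auto
    then have "frame_operator n \<mu> \<eta> x = y"
      by (intro qinner_eqI) (simp add: qinner_frame_operator[OF frame])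
    then show ?thesis ..
  qed
  then show "frame_operator n \<mu> \<eta> (SOME x. frame_operator n \<mu> \<eta> x = y) = y" for y
    by (rule someI_ex)
qed

section \<open>Dual frame and reconstruction\<close>

text \<open>Self-adjointness moves the inverse of the frame operator from \<open>\<eta> i q\<close>
  to the other argument, where \<open>\<psi>\<close> is a preimage of \<open>\<phi>\<close>.\<close>

lemma qinner_dual_frame:
  assumes frame: "continuous_frame n \<mu> \<eta> C D" and "frame_operator n \<mu> \<eta> \<psi> = \<phi>"
  shows "qinner \<psi> (\<eta> i q) = qinner \<phi> (dual_frame n \<mu> \<eta> i q)"
proof -
  let ?d = "dual_frame n \<mu> \<eta> i q"
  have d: "frame_operator n \<mu> \<eta> ?d = \<eta> i q"
    unfolding dual_frame_def by (rule surj_f_inv_f[OF surj_frame_operator[OF frame]])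
  have "qinner \<phi> ?d = qcnj (qinner ?d (frame_operator n \<mu> \<eta> \<psi>))"
    by (simp add: assms(2) qcnj_qinner)
  also have "\<dots> = qinner \<psi> (frame_operator n \<mu> \<eta> ?d)"
    unfolding qinner_frame_operator[OF frame] by (rule qcnj_frame_form[OF frame])
  finally show ?thesis by (simp add: d)
qed

text \<open>For a preimage \<open>\<psi>\<close> of \<open>\<phi>\<close>, self-adjointness turns
  \<open>frame_form n \<mu> \<eta> \<psi> \<phi>\<close> into \<open>qinner \<phi> \<phi>\<close>.
  The triangle inequality moves the norm inside the integrals, and the coefficients of
  \<open>\<psi>\<close> become those of the dual frame.\<close>

lemma frame_reconstruction_bound:
  assumes frame: "continuous_frame n \<mu> \<eta> C D"
  shows "ennreal ((norm \<phi>)\<^sup>2)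
    \<le> (\<Sum>i=1..n. \<integral>\<^sup>+ q. ennreal (norm (qinner (dual_frame n \<mu> \<eta> i q) \<phi>) * norm (qinner (\<eta> i q) \<phi>)) \<partial>\<mu>)"
proof -
  obtain \<psi> where \<psi>: "frame_operator n \<mu> \<eta> \<psi> = \<phi>" using surj_frame_operator[OF frame] by (metis surjD)
  have "frame_form n \<mu> \<eta> \<psi> \<phi> = qcnj (frame_form n \<mu> \<eta> \<phi> \<psi>)"
    by (rule qcnj_frame_form[OF frame, symmetric])
  also have "\<dots> = qinner \<phi> \<phi>"
    unfolding qinner_frame_operator[OF frame, symmetric] \<psi> by (rule qcnj_qinner)
  finally have "norm (frame_form n \<mu> \<eta> \<psi> \<phi>) = (norm \<phi>)\<^sup>2"
    by (simp add: qinner_self del: of_real_power)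
  then have "ennreal ((norm \<phi>)\<^sup>2) = ennreal (norm (frame_form n \<mu> \<eta> \<psi> \<phi>))" by simp
  also have "\<dots> \<le> ennreal (\<Sum>i=1..n. norm (\<integral>q. qinner \<psi> (\<eta> i q *\<^sub>Q qinner (\<eta> i q) \<phi>) \<partial>\<mu>))"
    unfolding frame_form_def by (intro ennreal_leI norm_sum)
  also have "\<dots> = (\<Sum>i=1..n. ennreal (norm (\<integral>q. qinner \<psi> (\<eta> i q *\<^sub>Q qinner (\<eta> i q) \<phi>) \<partial>\<mu>)))"
    by (simp add: sum_ennreal)
  also have "\<dots> \<le> (\<Sum>i=1..n. \<integral>\<^sup>+ q. ennreal (norm (qinner \<psi> (\<eta> i q *\<^sub>Q qinner (\<eta> i q) \<phi>))) \<partial>\<mu>)"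
    by (intro sum_mono integral_norm_bound_ennreal frame_integrable[OF frame])
  also have "\<dots> = (\<Sum>i=1..n. \<integral>\<^sup>+ q. ennreal (norm (qinner (dual_frame n \<mu> \<eta> i q) \<phi>) * norm (qinner (\<eta> i q) \<phi>)) \<partial>\<mu>)"
  proof -
    have "norm (qinner \<psi> (\<eta> i q *\<^sub>Q qinner (\<eta> i q) \<phi>))
        = norm (qinner (dual_frame n \<mu> \<eta> i q) \<phi>) * norm (qinner (\<eta> i q) \<phi>)" for i q
      unfolding qinner_qscale_right norm_quat_mult qinner_dual_frame[OF frame \<psi>]
      by (metis norm_qcnj qcnj_qinner)
    then show ?thesis by simp
  qed
  finally show ?thesis .
qed

section \<open>Gap and projection for the whole space\<close>

lemma gap_UNIV: "gap (UNIV :: 'a::right_quaternionic_hilbert set) UNIV = 0"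
proof (cases "(UNIV :: 'a set) = {0}")
  case False
  then obtain x :: 'a where "x \<noteq> 0" by blast
  \<comment> \<open>The supremum of the constant 0 is 0 only over a nonempty unit sphere; the
    trivial space is covered by the convention in \<open>gap\<close>.\<close>
  then have ne: "{\<phi> \<in> UNIV. norm (\<phi> :: 'a) = 1} \<noteq> {}"
    by (metis (mono_tags, lifting) UNIV_I empty_Collect_eq norm_sgn)
  have "(INF \<psi>. norm (\<phi> - \<psi>)) = 0" for \<phi> :: 'a
    by (intro antisym cINF_lower2[of _ _ \<phi>] cINF_greatest) (auto intro!: bdd_belowI[of _ 0])
  then show ?thesis using ne by (simp add: gap_def)
qed (simp add: gap_def)

lemma orthogonal_projection_UNIV: "orthogonal_projection UNIV \<phi> = \<phi>"
  unfolding orthogonal_projection_def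
proof (rule the_equality)
  show "\<phi> \<in> UNIV \<and> (\<forall>\<theta>\<in>UNIV. qinner \<theta> (\<phi> - \<phi>) = 0)"
    unfolding qinner_diff_right by simp
next
  fix \<psi> assume "\<psi> \<in> UNIV \<and> (\<forall>\<theta>\<in>UNIV. qinner \<theta> (\<phi> - \<psi>) = 0)"
  then show "\<psi> = \<phi>"
    by (intro qinner_eqI) (simp add: qinner_diff_right)
qed

section \<open>Perturbation bounds\<close>

text \<open>Minkowski's inequality for the coefficients of \<open>\<eta>\<close> and of
  \<open>\<eta> - \<Psi>\<close>, obtained from the weighted form with its optimal weight
  \<open>sqrt (l / M)\<close>.\<close>

lemma perturbed_frame_upper:
  assumes frame: "continuous_frame n \<mu> \<eta> C M" and \<Psi>: "weakly_measurable n \<mu> \<Psi>"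
    and lam: "(\<Sum>i=1..n. \<integral>\<^sup>+ q. ennreal ((norm (\<eta> i q - \<Psi> i q))\<^sup>2) \<partial>\<mu>) \<le> ennreal l" and "0 \<le> l"
    and \<phi>: "norm \<phi> = 1"
  shows "frame_sum n \<mu> \<Psi> \<phi> \<le> ennreal (M * (1 + sqrt (l / M))\<^sup>2)"
proof (rule ennreal_le_epsilon)
  have \<eta>: "weakly_measurable n \<mu> \<eta>" and "0 < M" using frame by (simp_all add: continuous_frame_iff)
  note [measurable] = measurable_qinner[OF \<Psi>] measurable_qinner[OF \<eta>]
  \<comment> \<open>Monotonicity of the integral holds for arbitrary integrands, which matters since
    \<open>norm (\<eta> i q - \<Psi> i q)\<close> carries no measurability assumption.\<close>
  have diff: "(\<Sum>i=1..n. \<integral>\<^sup>+ q. ennreal ((norm (qinner (\<eta> i q - \<Psi> i q) \<phi>))\<^sup>2) \<partial>\<mu>) \<le> ennreal l"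
    by (rule order_trans[OF _ lam], intro sum_mono nn_integral_mono ennreal_leI power_mono)
      (use qinner_Cauchy_Schwarz[of _ \<phi>] \<phi> in \<open>auto simp: \<phi>\<close>)
  have le: "frame_sum n \<mu> \<Psi> \<phi> \<le> ennreal ((1 + t) * M + (1 + 1 / t) * l)" if "0 < t" for t
  proof -
    have "frame_sum n \<mu> \<Psi> \<phi>
        \<le> (\<Sum>i=1..n. \<integral>\<^sup>+ q. ennreal ((norm (qinner (\<eta> i q) \<phi>) + norm (qinner (\<eta> i q - \<Psi> i q) \<phi>))\<^sup>2) \<partial>\<mu>)"
      unfolding frame_sum_def
    proof (intro sum_mono nn_integral_mono ennreal_leI power_mono)
      show "norm (qinner (\<Psi> i q) \<phi>) \<le> norm (qinner (\<eta> i q) \<phi>) + norm (qinner (\<eta> i q - \<Psi> i q) \<phi>)" for i q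
        unfolding qinner_diff_left by norm
    qed simp
    also have "\<dots> \<le> ennreal (1 + t) * frame_sum n \<mu> \<eta> \<phi> + ennreal (1 + 1 / t) *
        (\<Sum>i=1..n. \<integral>\<^sup>+ q. ennreal ((norm (qinner (\<eta> i q - \<Psi> i q) \<phi>))\<^sup>2) \<partial>\<mu>)"
      unfolding frame_sum_def
      by (intro sum_nn_integral_add_square_le that) (simp_all add: qinner_diff_left)
    also have "\<dots> \<le> ennreal (1 + t) * ennreal M + ennreal (1 + 1 / t) * ennreal l"
    proof (intro add_mono mult_left_mono diff)
      show "frame_sum n \<mu> \<eta> \<phi> \<le> ennreal M"
        using frame \<phi> unfolding continuous_frame_iff by (metis mult.right_neutral power_one)
    qed simp_all
    also have "\<dots> = ennreal ((1 + t) * M + (1 + 1 / t) * l)"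
      using that \<open>0 < M\<close> \<open>0 \<le> l\<close> by (simp add: ennreal_mult ennreal_plus)
    finally show ?thesis .
  qed
  fix e :: real assume "0 < e"
  show "frame_sum n \<mu> \<Psi> \<phi> \<le> ennreal (M * (1 + sqrt (l / M))\<^sup>2) + ennreal e"
  proof (cases "l = 0")
    \<comment> \<open>The optimal weight would be 0, which is not admissible; the weight
      \<open>e / M\<close> instead costs exactly the slack \<open>e\<close>.\<close>
    case True
    with le[of "e / M"] \<open>0 < e\<close> \<open>0 < M\<close> show ?thesis
      by (simp add: distrib_right ennreal_plus[symmetric] del: ennreal_plus)
  next
    case False
    \<comment> \<open>This weight minimises \<open>(1 + t) * M + (1 + 1 / t) * l\<close> and turns
      it into a perfect square.\<close>
    define t where "t = sqrt (l / M)"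
    have "0 < t" "l = M * t\<^sup>2" using False \<open>0 < M\<close> \<open>0 \<le> l\<close> by (simp_all add: t_def)
    then have "(1 + t) * M + (1 + 1 / t) * l = M * (1 + t)\<^sup>2"
      by (simp add: power2_eq_square field_simps)
    with le[OF \<open>0 < t\<close>] show ?thesis unfolding t_def[symmetric] by (simp add: add_increasing2)
  qed
qed

text \<open>With \<open>s\<close> the frame sum of \<open>\<Psi>\<close>, reconstruction and Young's
  inequality give \<open>1 - g \<le> t * D / 2 + s / (2 * t)\<close> for a positive weight
  \<open>t\<close>. The best choice of \<open>t\<close> yields
  \<open>s \<ge> (1 - g)\<^sup>2 / D\<close>.\<close>

lemma perturbed_frame_lower:
  assumes frame: "continuous_frame n \<mu> \<eta> B M" and dual: "continuous_frame n \<mu> (dual_frame n \<mu> \<eta>) C D"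
    and \<Psi>: "weakly_measurable n \<mu> \<Psi>"
    and gam: "(\<Sum>i=1..n. \<integral>\<^sup>+ q. ennreal (norm (\<eta> i q - \<Psi> i q) * norm (dual_frame n \<mu> \<eta> i q)) \<partial>\<mu>) \<le> ennreal g"
    and g: "0 \<le> g" "g < 1"
    and \<phi>: "norm \<phi> = 1" and fin: "frame_sum n \<mu> \<Psi> \<phi> < \<infinity>"
  shows "ennreal ((1 - g)\<^sup>2 / D) \<le> frame_sum n \<mu> \<Psi> \<phi>"
proof -
  let ?d = "dual_frame n \<mu> \<eta>"
  have \<eta>: "weakly_measurable n \<mu> \<eta>" using frame by (simp add: continuous_frame_iff)
  have d: "weakly_measurable n \<mu> ?d" and "0 < D" using dual by (simp_all add: continuous_frame_iff)
  note [measurable] = measurable_qinner[OF \<Psi>] measurable_qinner[OF \<eta>] measurable_qinner[OF d]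
  \<comment> \<open>Makes the dual frame contribute exactly half of \<open>1 - g\<close>, so the
    other half must come from \<open>\<Psi>\<close>.\<close>
  define t where "t = (1 - g) / D"
  have "0 < t" using g \<open>0 < D\<close> by (simp add: t_def)
  \<comment> \<open>Finiteness allows the final comparison to be carried out in the reals.\<close>
  obtain s where s: "frame_sum n \<mu> \<Psi> \<phi> = ennreal s" "0 \<le> s"
    using fin by (metis ennreal_cases infinity_ennreal_def less_irrefl)
  have "ennreal 1 \<le> (\<Sum>i=1..n. \<integral>\<^sup>+ q. ennreal (norm (qinner (?d i q) \<phi>) * norm (qinner (\<eta> i q) \<phi>)) \<partial>\<mu>)"
    using frame_reconstruction_bound[OF frame, of \<phi>] by (simp add: \<phi>)
  also have "\<dots> \<le> (\<Sum>i=1..n. \<integral>\<^sup>+ q. ennreal (norm (qinner (?d i q) \<phi>) * norm (qinner (\<Psi> i q) \<phi>))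
      + ennreal (norm (qinner (?d i q) \<phi>) * norm (qinner (\<eta> i q - \<Psi> i q) \<phi>)) \<partial>\<mu>)"
  proof (intro sum_mono nn_integral_mono)
    fix i q
    have "norm (qinner (\<eta> i q) \<phi>) \<le> norm (qinner (\<Psi> i q) \<phi>) + norm (qinner (\<eta> i q - \<Psi> i q) \<phi>)"
      unfolding qinner_diff_left by norm
    from mult_left_mono[OF this norm_ge_zero[of "qinner (?d i q) \<phi>"]]
    show "ennreal (norm (qinner (?d i q) \<phi>) * norm (qinner (\<eta> i q) \<phi>))
      \<le> ennreal (norm (qinner (?d i q) \<phi>) * norm (qinner (\<Psi> i q) \<phi>))
      + ennreal (norm (qinner (?d i q) \<phi>) * norm (qinner (\<eta> i q - \<Psi> i q) \<phi>))"
      by (simp add: distrib_left ennreal_plus[symmetric] ennreal_leI del: ennreal_plus)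
  qed
  also have "\<dots> = (\<Sum>i=1..n. \<integral>\<^sup>+ q. ennreal (norm (qinner (?d i q) \<phi>) * norm (qinner (\<Psi> i q) \<phi>)) \<partial>\<mu>)
      + (\<Sum>i=1..n. \<integral>\<^sup>+ q. ennreal (norm (qinner (?d i q) \<phi>) * norm (qinner (\<eta> i q - \<Psi> i q) \<phi>)) \<partial>\<mu>)"
    unfolding sum.distrib[symmetric]
    by (intro sum.cong refl nn_integral_add) (simp_all add: qinner_diff_left)
  also have "\<dots> \<le> (ennreal (t / 2) * frame_sum n \<mu> ?d \<phi> + ennreal (1 / (2 * t)) * frame_sum n \<mu> \<Psi> \<phi>) + ennreal g"
  proof (rule add_mono)
    show "(\<Sum>i=1..n. \<integral>\<^sup>+ q. ennreal (norm (qinner (?d i q) \<phi>) * norm (qinner (\<Psi> i q) \<phi>)) \<partial>\<mu>)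
        \<le> ennreal (t / 2) * frame_sum n \<mu> ?d \<phi> + ennreal (1 / (2 * t)) * frame_sum n \<mu> \<Psi> \<phi>"
      unfolding frame_sum_def by (intro sum_nn_integral_Young \<open>0 < t\<close>) simp_all
    \<comment> \<open>For a unit vector \<open>\<phi>\<close>, both coefficients in the error term
      are at most the norms that occur in \<open>gam\<close>.\<close>
    have bound: "norm (qinner x \<phi>) \<le> norm x" for x using qinner_Cauchy_Schwarz[of x \<phi>] by (simp add: \<phi>)
    show "(\<Sum>i=1..n. \<integral>\<^sup>+ q. ennreal (norm (qinner (?d i q) \<phi>) * norm (qinner (\<eta> i q - \<Psi> i q) \<phi>)) \<partial>\<mu>) \<le> ennreal g"
      by (rule order_trans[OF _ gam], intro sum_mono nn_integral_mono ennreal_leI)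
        (subst mult.commute, intro mult_mono bound norm_ge_zero)
  qed
  also have "\<dots> \<le> (ennreal (t / 2) * ennreal D + ennreal (1 / (2 * t)) * ennreal s) + ennreal g"
  proof -
    have "frame_sum n \<mu> ?d \<phi> \<le> ennreal D"
      using dual \<phi> unfolding continuous_frame_iff by (metis mult.right_neutral power_one)
    then show ?thesis unfolding s(1) by (intro add_mono mult_left_mono) simp_all
  qed
  also have "\<dots> = ennreal (t / 2 * D + 1 / (2 * t) * s + g)"
    using \<open>0 < t\<close> \<open>0 < D\<close> s(2) g(1)
    by (simp add: ennreal_mult[symmetric] ennreal_plus[symmetric] del: ennreal_plus)
  finally have "1 \<le> t / 2 * D + 1 / (2 * t) * s + g"
    using \<open>0 < t\<close> \<open>0 < D\<close> s(2) g(1) by (subst (asm) ennreal_le_iff) simp_all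
  moreover have "t / 2 * D = (1 - g) / 2" using \<open>0 < D\<close> by (simp add: t_def)
  ultimately have "1 - g \<le> s / t" by (simp add: field_simps)
  then have "(1 - g) * t \<le> s" using \<open>0 < t\<close> by (simp add: field_simps)
  then show ?thesis unfolding s(1) t_def by (intro ennreal_leI) (simp add: power2_eq_square)
qed

theorem theorem3p6:
  fixes \<mu> :: "quat measure"
    and n :: nat
    and \<eta> \<Psi> :: "nat \<Rightarrow> quat \<Rightarrow> 'a::right_quaternionic_hilbert"
    and A :: "'a \<Rightarrow> 'a"
    and K L :: "'a set"
    and C D :: real
    and lam gam :: ennreal
  assumes "space \<mu> = UNIV"
    and "1 \<le> n"
    and "A = frame_operator n \<mu> \<eta>"
    and "continuous_frame n \<mu> \<eta> (lower_form_bound A) (upper_form_bound A)"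
    and "continuous_frame n \<mu> (dual_frame n \<mu> \<eta>) C D"
    and "weakly_measurable n \<mu> \<Psi>"
    and "K = closed_right_span {\<Psi> i q | i q. i \<in> {1..n}}"
    and "L = closed_right_span {\<eta> i q | i q. i \<in> {1..n}}"
    and "gap K L < 1"
    and "lam = (\<Sum>i=1..n. \<integral>\<^sup>+ q. ennreal ((norm (\<eta> i q - \<Psi> i q))\<^sup>2) \<partial>\<mu>)"
    and "lam < \<infinity>"
    and "gam = (\<Sum>i=1..n. \<integral>\<^sup>+ q. ennreal (norm (\<eta> i q - \<Psi> i q) * norm (dual_frame n \<mu> \<eta> i q)) \<partial>\<mu>)"
    and "gam < 1"
  shows "continuous_frame n \<mu> \<Psi>
      ((1 - enn2real gam)\<^sup>2 / D)
      (upper_form_bound A * (1 + sqrt (enn2real lam / upper_form_bound A))\<^sup>2 * (1 / (1 - gap K L)\<^sup>2))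
    \<and> right_isomorphism_on K L (orthogonal_projection L)"
proof -
  let ?l = "enn2real lam" and ?g = "enn2real gam" and ?M = "upper_form_bound A"
  have "0 < ?M" using assms(4) by (simp add: continuous_frame_iff)
  have "0 < D" using assms(5) by (simp add: continuous_frame_iff)
  \<comment> \<open>\<open>enn2real\<close> sends infinity to 0, so finiteness is what makes
    \<open>?l\<close> and \<open>?g\<close> represent \<open>lam\<close> and
    \<open>gam\<close>.\<close>
  have l: "ennreal ?l = lam" using assms(11) by simp
  have "gam < \<infinity>" using assms(13) by (metis ennreal_one_less_top infinity_ennreal_def less_trans)
  then have g: "ennreal ?g = gam" by simp
  have "ennreal ?g < ennreal 1" using assms(13) unfolding g by simp
  then have "?g < 1" by (simp only: ennreal_less_iff enn2real_nonneg)
  have upper: "frame_sum n \<mu> \<Psi> \<phi> \<le> ennreal (?M * (1 + sqrt (?l / ?M))\<^sup>2)" if "norm \<phi> = 1" for \<phi>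
    using perturbed_frame_upper[OF assms(4,6) _ enn2real_nonneg that, of lam] assms(10) l by simp
  have lower: "ennreal ((1 - ?g)\<^sup>2 / D) \<le> frame_sum n \<mu> \<Psi> \<phi>" if "norm \<phi> = 1" for \<phi>
    \<comment> \<open>The upper estimate supplies the finiteness of the frame sum that the lower
      estimate requires.\<close>
    using perturbed_frame_lower[OF assms(4-6) _ enn2real_nonneg \<open>?g < 1\<close> that] assms(12) g
      order_le_less_trans[OF upper[OF that] ennreal_less_top] by simp
  have "0 < 1 + sqrt (?l / ?M)" using \<open>0 < ?M\<close> by (simp add: add_pos_nonneg)
  then have frame: "continuous_frame n \<mu> \<Psi> ((1 - ?g)\<^sup>2 / D) (?M * (1 + sqrt (?l / ?M))\<^sup>2)"
    using upper lower \<open>?g < 1\<close> \<open>0 < D\<close> \<open>0 < ?M\<close>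
    by (intro continuous_frameI_unit assms(6) divide_pos_pos mult_pos_pos zero_less_power) simp_all
  \<comment> \<open>Now that \<open>\<Psi>\<close> is a frame, its span is the whole space as well.
    The gap is therefore 0, the factor \<open>1 / (1 - gap K L)\<^sup>2\<close> equals 1, and the
    projection is the identity, with \<open>id\<close> as continuous inverse.\<close>
  have "K = UNIV" unfolding assms(7) by (rule continuous_frame_span[OF frame])
  moreover have "L = UNIV" unfolding assms(8) by (rule continuous_frame_span[OF assms(4)])
  moreover have "right_isomorphism_on UNIV UNIV (orthogonal_projection (UNIV :: 'a set))"
    unfolding right_isomorphism_on_def orthogonal_projection_UNIV
    by (auto simp: homeomorphism_def orthogonal_projection_UNIV intro!: exI[of _ id])
  ultimately show ?thesis using frame by (simp add: gap_UNIV)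
qed

end
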